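(* Let $\ell \in\mathbb{R}$, $\ell\neq 0$, and let $r \geq 2$ be an integer. Then there exists a proper $r$-harmonic $3$-Frenet helix $\gamma:\mathbb{R} \to M_{0,\ell}^3$ in the Heisenberg space $M^3_{0,\ell}$. Its Frenet field is of the form \[ \begin{aligned} T(s)&=\sin\alpha_o\cos\beta(s)E_1+\sin\alpha_o\sin\beta(s)E_2+\cos\alpha_o E_3,\\ N(s)&=-\sin\beta(s)E_1+\cos\beta(s)E_2,\\ B(s)&=-\cos\alpha_o\cos\beta(s)E_1-\cos\alpha_o\sin\beta(s)E_2+\sin\alpha_o E_3, \end{aligned} \] for some constant $\alpha_o\in(0,\pi)$, where $\beta(s)$ is a non-constant function of the type $\beta(s)=(\pm \zeta+\ell \cos\alpha_o)s+c$ with constants $\zeta>0$ and $c\in\mathbb{R}$.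
   Context: For $\ell\ne0$, the Heisenberg space is \[ M^3_{0,\ell}=\Big(\mathbb{R}^3,\ g=dx^2+dy^2+\Big[dz+\frac{\ell}{2}(y\,dx-x\,dy)\Big]^2\Big), \] with orthonormal frame $E_1=\partial_x-\frac{\ell y}{2}\partial_z$, $E_2=\partial_y+\frac{\ell x}{2}\partial_z$, $E_3=\partial_z$, taken positively oriented. Let $\nabla$ be the Levi-Civita connection and $R(X,Y)Z=\nabla_X\nabla_YZ-\nabla_Y\nabla_XZ-\nabla_{[X,Y]}Z$. Curves are smooth and parametrized by arc length $s$, with $T=\gamma'$, $\nabla^0_TT=T$, $\nabla_T^kT=\nabla_T(\nabla_T^{k-1}T)$. For an integer $r\ge 2$, $\gamma$ is $r$-harmonic if \[ \tau_r(\gamma)=\nabla^{2r-1}_T T+ \sum_{j=0}^{r-2}(-1)^j R\left (\nabla^{2r-3-j}_T T ,\nabla^{j}_T T\right )T=0, \] and proper $r$-harmonic if it is $r$-harmonic and not a geodesic. A $3$-Frenet helix in $M^3_{0,\ell}$ is such a curve admitting a positively oriented orthonormal field $\{T,N,B\}$ (with $B=T\wedge N$) and constants $\kappa>0$, $\tau\in\mathbb{R}$ with $\nabla_TT=\kappa N$, $\nabla_TN=-\kappa T+\tau B$, $\nabla_TB=-\tau N$. *)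

theory Defs
  imports "HOL-Analysis.Analysis"
begin

section \<open>Riemannian metrics on \<open>\<real>\<^sup>n\<close> in the global chart\<close>

text \<open>
  A metric is given by its matrix \<open>g p $ i $ j = g\<^sub>i\<^sub>j(p)\<close> in the coordinate frame; tangent vectors
  and vector fields (also those along a curve) are given by their coordinate components.
  All derivatives below are the total library operators, which are meaningful only where the
  argument is differentiable.
\<close>

type_synonym 'n metric = "real^'n \<Rightarrow> real^'n^'n"
type_synonym 'n vfield = "real^'n \<Rightarrow> real^'n"

definition metric_inner :: "'n::finite metric \<Rightarrow> real^'n \<Rightarrow> real^'n \<Rightarrow> real^'n \<Rightarrow> real"
  where "metric_inner g p u v = (\<Sum>i\<in>UNIV. \<Sum>j\<in>UNIV. g p $ i $ j * u $ i * v $ j)"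

definition coord_partial :: "'n::finite \<Rightarrow> (real^'n \<Rightarrow> real) \<Rightarrow> real^'n \<Rightarrow> real"
  where "coord_partial i f p = frechet_derivative f (at p) (axis i 1)"

text \<open>\<open>christoffel g k i j p\<close> is \<open>\<Gamma>\<^sup>k\<^sub>i\<^sub>j(p)\<close>, the Christoffel symbol of the Levi-Civita connection.\<close>

definition christoffel :: "'n::finite metric \<Rightarrow> 'n \<Rightarrow> 'n \<Rightarrow> 'n \<Rightarrow> real^'n \<Rightarrow> real"
  where "christoffel g k i j p =
    (1/2) * (\<Sum>m\<in>UNIV. matrix_inv (g p) $ k $ m *
      (coord_partial i (\<lambda>q. g q $ j $ m) p
       + coord_partial j (\<lambda>q. g q $ i $ m) p
       - coord_partial m (\<lambda>q. g q $ i $ j) p))"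

definition christoffel_term :: "'n::finite metric \<Rightarrow> real^'n \<Rightarrow> real^'n \<Rightarrow> real^'n \<Rightarrow> real^'n"
  where "christoffel_term g p u v =
    (\<chi> k. \<Sum>i\<in>UNIV. \<Sum>j\<in>UNIV. christoffel g k i j p * u $ i * v $ j)"

definition levi_civita :: "'n::finite metric \<Rightarrow> 'n vfield \<Rightarrow> 'n vfield \<Rightarrow> 'n vfield"
  where "levi_civita g X Y p =
    frechet_derivative Y (at p) (X p) + christoffel_term g p (X p) (Y p)"

definition lie_bracket :: "'n::finite vfield \<Rightarrow> 'n vfield \<Rightarrow> 'n vfield"
  where "lie_bracket X Y p =
    frechet_derivative Y (at p) (X p) - frechet_derivative X (at p) (Y p)"

definition curvature_op ::
    "'n::finite metric \<Rightarrow> 'n vfield \<Rightarrow> 'n vfield \<Rightarrow> 'n vfield \<Rightarrow> 'n vfield"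
  where "curvature_op g X Y Z p =
    levi_civita g X (levi_civita g Y Z) p - levi_civita g Y (levi_civita g X Z) p
    - levi_civita g (lie_bracket X Y) Z p"

text \<open>
  The value of the curvature tensor on tangent vectors at \<open>p\<close>. By tensoriality any extension
  of the vectors to vector fields may be used; here they are extended with constant components.
\<close>

definition curvature :: "'n::finite metric \<Rightarrow> real^'n \<Rightarrow> real^'n \<Rightarrow> real^'n \<Rightarrow> real^'n \<Rightarrow> real^'n"
  where "curvature g p u v w = curvature_op g (\<lambda>_. u) (\<lambda>_. v) (\<lambda>_. w) p"


section \<open>Curves and \<open>r\<close>-harmonicity\<close>

definition velocity :: "(real \<Rightarrow> 'a::real_normed_vector) \<Rightarrow> real \<Rightarrow> 'a"
  where "velocity \<gamma> s = vector_derivative \<gamma> (at s)"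

definition smooth_curve :: "(real \<Rightarrow> 'a::real_normed_vector) \<Rightarrow> bool"
  where "smooth_curve \<gamma> \<longleftrightarrow> (\<forall>k s. (velocity ^^ k) \<gamma> differentiable (at s))"

definition arclength_curve :: "'n::finite metric \<Rightarrow> (real \<Rightarrow> real^'n) \<Rightarrow> bool"
  where "arclength_curve g \<gamma> \<longleftrightarrow>
    smooth_curve \<gamma> \<and> (\<forall>s. metric_inner g (\<gamma> s) (velocity \<gamma> s) (velocity \<gamma> s) = 1)"

text \<open>Covariant derivative \<open>\<nabla>\<^sub>T V\<close> of a vector field \<open>V\<close> along \<open>\<gamma>\<close>, where \<open>T = \<gamma>'\<close>.\<close>

definition cov_along ::
    "'n::finite metric \<Rightarrow> (real \<Rightarrow> real^'n) \<Rightarrow> (real \<Rightarrow> real^'n) \<Rightarrow> real \<Rightarrow> real^'n"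
  where "cov_along g \<gamma> V s =
    vector_derivative V (at s) + christoffel_term g (\<gamma> s) (velocity \<gamma> s) (V s)"

definition nabla_T :: "'n::finite metric \<Rightarrow> (real \<Rightarrow> real^'n) \<Rightarrow> nat \<Rightarrow> real \<Rightarrow> real^'n"
  where "nabla_T g \<gamma> k = (cov_along g \<gamma> ^^ k) (velocity \<gamma>)"

definition r_tension :: "'n::finite metric \<Rightarrow> nat \<Rightarrow> (real \<Rightarrow> real^'n) \<Rightarrow> real \<Rightarrow> real^'n"
  where "r_tension g r \<gamma> s =
    nabla_T g \<gamma> (2 * r - 1) s
    + (\<Sum>j = 0..r - 2. (- 1) ^ j *\<^sub>R
        curvature g (\<gamma> s) (nabla_T g \<gamma> (2 * r - 3 - j) s) (nabla_T g \<gamma> j s) (velocity \<gamma> s))"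

text \<open>Meaningful for \<open>r \<ge> 2\<close> only.\<close>

definition r_harmonic :: "'n::finite metric \<Rightarrow> nat \<Rightarrow> (real \<Rightarrow> real^'n) \<Rightarrow> bool"
  where "r_harmonic g r \<gamma> \<longleftrightarrow> arclength_curve g \<gamma> \<and> (\<forall>s. r_tension g r \<gamma> s = 0)"

definition geodesic :: "'n::finite metric \<Rightarrow> (real \<Rightarrow> real^'n) \<Rightarrow> bool"
  where "geodesic g \<gamma> \<longleftrightarrow> (\<forall>s. cov_along g \<gamma> (velocity \<gamma>) s = 0)"

definition proper_r_harmonic :: "'n::finite metric \<Rightarrow> nat \<Rightarrow> (real \<Rightarrow> real^'n) \<Rightarrow> bool"
  where "proper_r_harmonic g r \<gamma> \<longleftrightarrow> r_harmonic g r \<gamma> \<and> \<not> geodesic g \<gamma>"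


section \<open>The Heisenberg space\<close>

text \<open>Components of the one-form \<open>dz + (l/2) (y dx - x dy)\<close>; \<open>x, y, z\<close> are \<open>p $ 1, p $ 2, p $ 3\<close>.\<close>

definition heis_form :: "real \<Rightarrow> real^3 \<Rightarrow> real^3"
  where "heis_form l p = vector [l / 2 * p $ 2, - (l / 2 * p $ 1), 1]"

definition heis_metric :: "real \<Rightarrow> 3 metric"
  where "heis_metric l p =
    (\<chi> i j. axis 1 1 $ i * axis 1 1 $ j + axis 2 1 $ i * axis 2 1 $ j
           + heis_form l p $ i * heis_form l p $ j)"

definition heis_E1 :: "real \<Rightarrow> 3 vfield"
  where "heis_E1 l p = vector [1, 0, - (l * p $ 2 / 2)]"

definition heis_E2 :: "real \<Rightarrow> 3 vfield"
  where "heis_E2 l p = vector [0, 1, l * p $ 1 / 2]"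

definition heis_E3 :: "real \<Rightarrow> 3 vfield"
  where "heis_E3 l p = vector [0, 0, 1]"

text \<open>The tangent vector at \<open>p\<close> with frame components \<open>a\<close>, and the inverse operation.\<close>

definition heis_vec :: "real \<Rightarrow> real^3 \<Rightarrow> real^3 \<Rightarrow> real^3"
  where "heis_vec l p a = a $ 1 *\<^sub>R heis_E1 l p + a $ 2 *\<^sub>R heis_E2 l p + a $ 3 *\<^sub>R heis_E3 l p"

definition heis_comp :: "real \<Rightarrow> real^3 \<Rightarrow> real^3 \<Rightarrow> real^3"
  where "heis_comp l p u =
    vector [metric_inner (heis_metric l) p u (heis_E1 l p),
            metric_inner (heis_metric l) p u (heis_E2 l p),
            metric_inner (heis_metric l) p u (heis_E3 l p)]"

text \<open>
  Vector product of the oriented Euclidean space \<open>T\<^sub>pM\<close>: the usual one in terms of the components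
  with respect to the frame \<open>E\<^sub>1, E\<^sub>2, E\<^sub>3\<close>, which is declared to be positively oriented.
\<close>

definition heis_wedge :: "real \<Rightarrow> real^3 \<Rightarrow> real^3 \<Rightarrow> real^3 \<Rightarrow> real^3"
  where "heis_wedge l p u v = heis_vec l p (cross3 (heis_comp l p u) (heis_comp l p v))"

text \<open>
  \<open>T = velocity \<gamma>\<close>, and positive orientation of \<open>T, N, B\<close> is expressed by \<open>B = T \<and> N\<close>.
\<close>

definition frenet_helix ::
    "real \<Rightarrow> (real \<Rightarrow> real^3) \<Rightarrow> (real \<Rightarrow> real^3) \<Rightarrow> (real \<Rightarrow> real^3) \<Rightarrow> real \<Rightarrow> real \<Rightarrow> bool"
  where "frenet_helix l \<gamma> N B \<kappa> \<tau> \<longleftrightarrow>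
    (let g = heis_metric l; T = velocity \<gamma> in
      arclength_curve g \<gamma> \<and> smooth_curve N \<and> smooth_curve B \<and>
      (\<forall>s. metric_inner g (\<gamma> s) (T s) (T s) = 1 \<and>
           metric_inner g (\<gamma> s) (N s) (N s) = 1 \<and>
           metric_inner g (\<gamma> s) (B s) (B s) = 1 \<and>
           metric_inner g (\<gamma> s) (T s) (N s) = 0 \<and>
           metric_inner g (\<gamma> s) (T s) (B s) = 0 \<and>
           metric_inner g (\<gamma> s) (N s) (B s) = 0 \<and>
           B s = heis_wedge l (\<gamma> s) (T s) (N s)) \<and>
      \<kappa> > 0 \<and>
      (\<forall>s. cov_along g \<gamma> T s = \<kappa> *\<^sub>R N s \<and>
           cov_along g \<gamma> N s = - \<kappa> *\<^sub>R T s + \<tau> *\<^sub>R B s \<and>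
           cov_along g \<gamma> B s = - \<tau> *\<^sub>R N s))"

end

theory Submission
  imports Defs
begin

text \<open>
  A curve whose tangent makes a constant angle \<open>\<alpha>\<close> with \<open>E\<^sub>3\<close> and whose horizontal part rotates at
  constant speed \<open>\<zeta> + l cos \<alpha>\<close> is a Frenet helix with \<open>\<kappa> = \<zeta> sin \<alpha>\<close> and
  \<open>\<tau> = \<zeta> cos \<alpha> + l/2\<close>. Since \<open>\<nabla>\<^sub>T\<close> acts on the Frenet field by a constant matrix, all iterated
  derivatives \<open>\<nabla>\<^sub>T\<^sup>k T\<close> are explicit, and \<open>R(N,T)T\<close> and \<open>R(N,B)T\<close> are constant multiples of \<open>N\<close>,
  say by \<open>a\<close> and \<open>b\<close>. Hence \<open>\<tau>\<^sub>r\<close> is a multiple of \<open>N\<close> and vanishes if and only if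
  \<open>w\<^sup>2 - w a + (r - 2) \<kappa> (\<tau> b - \<kappa> a) = 0\<close>, where \<open>w = \<kappa>\<^sup>2 + \<tau>\<^sup>2\<close>.
  Fixing \<open>\<zeta> = \<bar>l\<bar>/4\<close>, this becomes a polynomial equation in \<open>\<bar>cos \<alpha>\<bar>\<close>, solved
  by the intermediate value theorem for every \<open>r \<ge> 2\<close>.
\<close>

section \<open>Christoffel symbols of the Heisenberg metric\<close>

lemma vec3_eqI: "x $ 1 = y $ 1 \<Longrightarrow> x $ 2 = y $ 2 \<Longrightarrow> x $ 3 = y $ 3 \<Longrightarrow> x = (y :: 'a^3)"
  by (simp add: vec_eq_iff forall_3)

lemma has_derivative_vector_3:
  fixes f1 f2 f3 :: "'a::real_normed_vector \<Rightarrow> real"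
  assumes "(f1 has_derivative f1') F" "(f2 has_derivative f2') F" "(f3 has_derivative f3') F"
  shows "((\<lambda>x. vector [f1 x, f2 x, f3 x] :: real^3) has_derivative
    (\<lambda>h. vector [f1' h, f2' h, f3' h])) F"
proof -
  have *: "vector [a, b, c] = a *\<^sub>R axis 1 1 + b *\<^sub>R axis 2 1 + c *\<^sub>R (axis 3 1 :: real^3)" for a b c :: real
    by (rule vec3_eqI) (simp_all add: axis_def)
  show ?thesis
    unfolding * by (intro has_derivative_add has_derivative_scaleR_left assms)
qed

lemma has_derivative_vec_nth [derivative_intros]:
  "((\<lambda>x. x $ i) has_derivative (\<lambda>h. h $ i)) (at p within S)"
  using bounded_linear_vec_nth by (rule bounded_linear_imp_has_derivative)

lemma heis_form_has_derivative:
  "(heis_form l has_derivative (\<lambda>h. vector [l / 2 * h $ 2, - (l / 2 * h $ 1), 0])) (at p)"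
  unfolding heis_form_def[abs_def]
  by (intro has_derivative_vector_3) (auto intro!: derivative_eq_intros)

text \<open>Only the rank one summand built from \<open>heis_form\<close> varies with the point, so
  this is the product rule; the vector on the right is the derivative of \<open>heis_form\<close> in
  direction \<open>m\<close>.\<close>

lemma coord_partial_heis_metric:
  "coord_partial m (\<lambda>q. heis_metric l q $ i $ j) p =
    (vector [l / 2 * axis m 1 $ 2, - (l / 2 * axis m 1 $ 1), 0] :: real^3) $ i * heis_form l p $ j
    + heis_form l p $ i * (vector [l / 2 * axis m 1 $ 2, - (l / 2 * axis m 1 $ 1), 0] :: real^3) $ j"
proof -
  note d = bounded_linear.has_derivative[OF bounded_linear_vec_nth heis_form_has_derivative]
  have "((\<lambda>q. heis_metric l q $ i $ j) has_derivative
     (\<lambda>h. heis_form l p $ i * (vector [l / 2 * h $ 2, - (l / 2 * h $ 1), 0] :: real^3) $ j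
        + (vector [l / 2 * h $ 2, - (l / 2 * h $ 1), 0] :: real^3) $ i * heis_form l p $ j)) (at p)"
    using has_derivative_add[OF has_derivative_const has_derivative_mult[OF d d]]
    by (simp add: heis_metric_def)
  from frechet_derivative_at[OF this, symmetric] show ?thesis
    unfolding coord_partial_def by simp
qed

text \<open>For an orthonormal frame the inverse metric is the sum of the tensor squares of the
  frame fields.\<close>

lemma matrix_inv_heis_metric:
  "matrix_inv (heis_metric l p) $ i $ j =
    heis_E1 l p $ i * heis_E1 l p $ j + heis_E2 l p $ i * heis_E2 l p $ j
    + heis_E3 l p $ i * heis_E3 l p $ j"
proof -
  define H :: "real^3^3" where "H = (\<chi> i j. heis_E1 l p $ i * heis_E1 l p $ j
    + heis_E2 l p $ i * heis_E2 l p $ j + heis_E3 l p $ i * heis_E3 l p $ j)"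
  have "heis_metric l p ** H = mat 1" "H ** heis_metric l p = mat 1"
    by (simp_all add: H_def matrix_matrix_mult_def mat_def vec_eq_iff forall_3 sum_3
        heis_metric_def heis_form_def heis_E1_def heis_E2_def heis_E3_def axis_def field_simps)
  \<comment> \<open>\<open>matrix_inv\<close> chooses some two-sided inverse; inverses are unique,
    so the choice is \<open>H\<close>.\<close>
  then have "matrix_inv (heis_metric l p) = H"
    unfolding matrix_inv_def
    by (metis (mono_tags, lifting) matrix_mul_assoc matrix_mul_lid matrix_mul_rid someI_ex)
  then show ?thesis by (simp add: H_def)
qed

text \<open>The derivative of \<open>heis_form\<close> is skew-symmetric, so in the Koszul formula
  only its exterior derivative, a multiple of \<open>dx \<and> dy\<close>, survives. Hence there is
  no component along \<open>heis_E3\<close>, and every factor is affine in \<open>p\<close>.\<close>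

lemma christoffel_term_heis:
  "christoffel_term (heis_metric l) p u v =
    (l / 2 * (u $ 2 * (heis_form l p \<bullet> v) + (heis_form l p \<bullet> u) * v $ 2)) *\<^sub>R heis_E1 l p
    - (l / 2 * (u $ 1 * (heis_form l p \<bullet> v) + (heis_form l p \<bullet> u) * v $ 1)) *\<^sub>R heis_E2 l p"
proof -
  note s = christoffel_term_def christoffel_def coord_partial_heis_metric matrix_inv_heis_metric
      sum_3 axis_def heis_form_def heis_E1_def heis_E2_def heis_E3_def inner_vec_def
  show ?thesis
    by (rule vec3_eqI) (simp_all add: s field_simps)
qed

section \<open>Curvature in the orthonormal frame\<close>

lemma heis_E1_has_derivative: "(heis_E1 l has_derivative (\<lambda>h. vector [0, 0, - (l * h $ 2 / 2)])) (at p)"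
  unfolding heis_E1_def[abs_def]
  by (intro has_derivative_vector_3) (auto intro!: derivative_eq_intros)

lemma heis_E2_has_derivative: "(heis_E2 l has_derivative (\<lambda>h. vector [0, 0, l * h $ 1 / 2])) (at p)"
  unfolding heis_E2_def[abs_def]
  by (intro has_derivative_vector_3) (auto intro!: derivative_eq_intros)

lemma heis_vec_nth:
  "heis_vec l p a $ 1 = a $ 1"
  "heis_vec l p a $ 2 = a $ 2"
  "heis_vec l p a $ 3 = a $ 3 + l / 2 * (p $ 1 * a $ 2 - p $ 2 * a $ 1)"
  by (simp_all add: heis_vec_def heis_E1_def heis_E2_def heis_E3_def algebra_simps)

lemma heis_form_heis_vec: "heis_form l p \<bullet> heis_vec l p a = a $ 3"
  by (simp add: inner_vec_def sum_3 heis_vec_nth heis_form_def algebra_simps)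

text \<open>Here \<open>A h u\<close> is the derivative of \<open>heis_form l q \<bullet> u\<close>
  in direction \<open>h\<close>. The multiple of \<open>axis 3 1\<close> comes from differentiating
  the frame fields, whose first two coordinates are constant.\<close>

lemma christoffel_term_heis_has_derivative:
  fixes l :: real and v w :: "real^3"
  defines "A \<equiv> (\<lambda>h u. l / 2 * (h $ 2 * u $ 1 - h $ 1 * u $ 2))"
  shows "((\<lambda>q. christoffel_term (heis_metric l) q v w) has_derivative
    (\<lambda>h. (l / 2 * (v $ 2 * A h w + A h v * w $ 2)) *\<^sub>R heis_E1 l p
      - (l / 2 * (v $ 1 * A h w + A h v * w $ 1)) *\<^sub>R heis_E2 l p
      - (l\<^sup>2 / 4 * (v $ 2 * (heis_form l p \<bullet> w) + (heis_form l p \<bullet> v) * w $ 2) * h $ 2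
        + l\<^sup>2 / 4 * (v $ 1 * (heis_form l p \<bullet> w) + (heis_form l p \<bullet> v) * w $ 1) * h $ 1) *\<^sub>R axis 3 1))
    (at p)"
  unfolding christoffel_term_heis
  apply (rule derivative_eq_intros heis_E1_has_derivative heis_E2_has_derivative
      heis_form_has_derivative refl)+
  apply (rule ext, rule vec3_eqI)
    apply (simp_all add: A_def inner_vec_def sum_3 axis_def heis_E1_def heis_E2_def
      algebra_simps power2_eq_square)
  done

text \<open>Constant fields commute, and the covariant derivative of one along another is the
  Christoffel term alone. What remains is its derivative plus a quadratic term, antisymmetrised in
  \<open>u\<close> and \<open>v\<close>.\<close>

lemma curvature_const:
  assumes "\<And>v w. ((\<lambda>q. christoffel_term g q v w) has_derivative D v w) (at p)"
  shows "curvature g p u v w =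
    D v w u + christoffel_term g p u (christoffel_term g p v w)
    - (D u w v + christoffel_term g p v (christoffel_term g p u w))"
proof -
  have c: "levi_civita g (\<lambda>_. v) (\<lambda>_. w) = (\<lambda>q. christoffel_term g q v w)" for v w
    by (simp add: levi_civita_def fun_eq_iff)
  have "lie_bracket (\<lambda>_. u) (\<lambda>_. v) = (\<lambda>_. 0)"
    by (simp add: lie_bracket_def fun_eq_iff)
  moreover have "christoffel_term g p 0 w = 0"
    by (simp add: christoffel_term_def vec_eq_iff)
  ultimately show ?thesis
    unfolding curvature_def curvature_op_def c
    by (simp add: levi_civita_def frechet_derivative_at[OF assms, symmetric])
qed

text \<open>
  In the frame the curvature operator is diagonal on bivectors, with the sectional curvatures
  \<open>l\<^sup>2/4\<close>, \<open>l\<^sup>2/4\<close>, \<open>- 3 l\<^sup>2/4\<close> of the planes orthogonal to \<open>E\<^sub>1\<close>, \<open>E\<^sub>2\<close>, \<open>E\<^sub>3\<close>.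
\<close>

lemma curvature_heis:
  "curvature (heis_metric l) p (heis_vec l p a) (heis_vec l p b) (heis_vec l p c) =
    heis_vec l p (cross3 c (vector [l\<^sup>2 / 4 * cross3 a b $ 1, l\<^sup>2 / 4 * cross3 a b $ 2,
      - (3 * l\<^sup>2 / 4) * cross3 a b $ 3]))"
  unfolding curvature_const[OF christoffel_term_heis_has_derivative]
  unfolding christoffel_term_heis
  by (rule vec3_eqI; simp add: heis_form_heis_vec heis_vec_nth cross3_def heis_E1_def heis_E2_def
     axis_def inner_vec_def sum_3 heis_form_def; simp add: field_simps power2_eq_square)

section \<open>Passage between coordinates and frame components\<close>

lemma heis_vec_add: "heis_vec l p (a + b) = heis_vec l p a + heis_vec l p b"
  and heis_vec_scaleR: "heis_vec l p (x *\<^sub>R a) = x *\<^sub>R heis_vec l p a"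
  by (simp_all add: heis_vec_def algebra_simps)

text \<open>Transfers identities proved for frame components to arbitrary tangent vectors.\<close>

lemma heis_vec_surj: obtains a where "u = heis_vec l p a"
proof
  show "u = heis_vec l p (vector [u $ 1, u $ 2, heis_form l p \<bullet> u])"
    by (rule vec3_eqI) (simp_all add: heis_vec_nth inner_vec_def sum_3 heis_form_def algebra_simps)
qed

lemma metric_inner_heis_vec:
  "metric_inner (heis_metric l) p (heis_vec l p a) (heis_vec l p b) = a \<bullet> b"
  by (simp add: metric_inner_def sum_3 heis_metric_def heis_form_def heis_vec_nth axis_def inner_vec_def)
    (simp add: field_simps)

lemma heis_E_eq_heis_vec:
  "heis_E1 l p = heis_vec l p (axis 1 1)"
  "heis_E2 l p = heis_vec l p (axis 2 1)"
  "heis_E3 l p = heis_vec l p (axis 3 1)"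
  by (simp_all add: heis_vec_def axis_def)

lemma heis_wedge_heis_vec:
  "heis_wedge l p (heis_vec l p a) (heis_vec l p b) = heis_vec l p (cross3 a b)"
proof -
  have "heis_comp l p (heis_vec l p a) = a" for a
    unfolding heis_comp_def heis_E_eq_heis_vec metric_inner_heis_vec
    by (rule vec3_eqI) (simp_all add: inner_axis)
  then show ?thesis by (simp add: heis_wedge_def)
qed

lemma curvature_heis_swap:
  "curvature (heis_metric l) p v u w = - curvature (heis_metric l) p u v w"
proof -
  obtain a b c where "u = heis_vec l p a" "v = heis_vec l p b" "w = heis_vec l p c"
    using heis_vec_surj by metis
  then show ?thesis
    by (simp add: curvature_heis vec3_eqI heis_vec_nth cross3_def algebra_simps)
qed

text \<open>Linearity is not visible in the definition by constant extensions, but it is in the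
  cross product formula. The second argument has the shape needed for
  \<open>- \<kappa> T + \<tau> B\<close>.\<close>

lemma curvature_heis_linear:
  "curvature (heis_metric l) p (x *\<^sub>R u) (y *\<^sub>R v + z *\<^sub>R v') w =
    (x * y) *\<^sub>R curvature (heis_metric l) p u v w + (x * z) *\<^sub>R curvature (heis_metric l) p u v' w"
proof -
  obtain a b b' c where "u = heis_vec l p a" "v = heis_vec l p b" "v' = heis_vec l p b'"
    "w = heis_vec l p c"
    using heis_vec_surj by metis
  show ?thesis
    unfolding \<open>u = _\<close> \<open>v = _\<close> \<open>v' = _\<close> \<open>w = _\<close>
      heis_vec_add[symmetric] heis_vec_scaleR[symmetric] curvature_heis
    by (rule arg_cong[where f = "heis_vec l p"], rule vec3_eqI)
      (simp_all add: cross3_def algebra_simps)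
qed

section \<open>Iterated covariant derivatives and tension along a Frenet helix\<close>

lemma christoffel_term_linear:
  "christoffel_term g p u (x *\<^sub>R v + y *\<^sub>R w) =
    x *\<^sub>R christoffel_term g p u v + y *\<^sub>R christoffel_term g p u w"
  by (simp add: christoffel_term_def vec_eq_iff sum_distrib_left sum.distrib algebra_simps)

lemma cov_along_linear:
  assumes "V differentiable (at s)" "W differentiable (at s)"
  shows "cov_along g \<gamma> (\<lambda>s. x *\<^sub>R V s + y *\<^sub>R W s) s =
    x *\<^sub>R cov_along g \<gamma> V s + y *\<^sub>R cov_along g \<gamma> W s"
proof -
  have "((\<lambda>s. x *\<^sub>R V s + y *\<^sub>R W s) has_vector_derivative
      x *\<^sub>R vector_derivative V (at s) + y *\<^sub>R vector_derivative W (at s)) (at s)"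
    using assms by (auto intro!: derivative_eq_intros simp: vector_derivative_works)
  then show ?thesis
    by (simp add: cov_along_def christoffel_term_linear vector_derivative_at algebra_simps)
qed

text \<open>With \<open>V = - \<kappa> T + \<tau> B\<close>, the Frenet equations send
  \<open>N\<close> to \<open>V\<close> and \<open>V\<close> to \<open>- w N\<close>. So after
  \<open>\<kappa> N\<close> the derivatives alternate between multiples of \<open>N\<close> and
  \<open>V\<close>, gaining a factor \<open>- w\<close> every two steps.\<close>

lemma nabla_T_frenet:
  fixes \<kappa> \<tau> :: real
  defines "w \<equiv> \<kappa>\<^sup>2 + \<tau>\<^sup>2"
  assumes diff: "\<And>s. velocity \<gamma> differentiable (at s)" "\<And>s. N differentiable (at s)"
      "\<And>s. B differentiable (at s)"
    and frenet: "\<And>s. cov_along g \<gamma> (velocity \<gamma>) s = \<kappa> *\<^sub>R N s"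
      "\<And>s. cov_along g \<gamma> N s = - \<kappa> *\<^sub>R velocity \<gamma> s + \<tau> *\<^sub>R B s"
      "\<And>s. cov_along g \<gamma> B s = - \<tau> *\<^sub>R N s"
  shows "nabla_T g \<gamma> (2 * m + 1) = (\<lambda>s. ((- w) ^ m * \<kappa>) *\<^sub>R N s)"
    and "nabla_T g \<gamma> (2 * m + 2) =
      (\<lambda>s. ((- w) ^ m * \<kappa>) *\<^sub>R (- \<kappa> *\<^sub>R velocity \<gamma> s + \<tau> *\<^sub>R B s))"
proof -
  have Suc: "nabla_T g \<gamma> (Suc k) = cov_along g \<gamma> (nabla_T g \<gamma> k)" for k
    by (simp add: nabla_T_def)
  have even: "nabla_T g \<gamma> (2 * m + 2) =
      (\<lambda>s. ((- w) ^ m * \<kappa>) *\<^sub>R (- \<kappa> *\<^sub>R velocity \<gamma> s + \<tau> *\<^sub>R B s))"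
    if "nabla_T g \<gamma> (2 * m + 1) = (\<lambda>s. ((- w) ^ m * \<kappa>) *\<^sub>R N s)" for m
  proof -
    \<comment> \<open>The zero summand gives the two-term shape of
      \<open>cov_along_linear\<close>.\<close>
    have "nabla_T g \<gamma> (2 * m + 2) = cov_along g \<gamma> (\<lambda>s. ((- w) ^ m * \<kappa>) *\<^sub>R N s + 0 *\<^sub>R N s)"
      using Suc[of "2 * m + 1"] that by simp
    then show ?thesis
      by (simp only: cov_along_linear[OF diff(2,2)] frenet fun_eq_iff) simp
  qed
  have odd: "nabla_T g \<gamma> (2 * m + 1) = (\<lambda>s. ((- w) ^ m * \<kappa>) *\<^sub>R N s)" for m
  proof (induction m)
    case 0
    show ?case using Suc[of 0] by (simp add: fun_eq_iff frenet) (simp add: nabla_T_def frenet)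
  next
    case (Suc m)
    have "nabla_T g \<gamma> (2 * m + 2) =
        (\<lambda>s. (- ((- w) ^ m * \<kappa> * \<kappa>)) *\<^sub>R velocity \<gamma> s + ((- w) ^ m * \<kappa> * \<tau>) *\<^sub>R B s)"
      unfolding even[OF Suc.IH] by (simp add: algebra_simps)
    then have "nabla_T g \<gamma> (2 * Suc m + 1) = (\<lambda>s. (- ((- w) ^ m * \<kappa> * \<kappa>)) *\<^sub>R \<kappa> *\<^sub>R N s
        + ((- w) ^ m * \<kappa> * \<tau>) *\<^sub>R - \<tau> *\<^sub>R N s)"
      using \<open>\<And>k. nabla_T g \<gamma> (Suc k) = _ k\<close>[of "2 * m + 2"]
      by (simp only: cov_along_linear[OF diff(1,3)] frenet fun_eq_iff) (simp add: frenet)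
    also have "\<dots> = (\<lambda>s. ((- w) ^ Suc m * \<kappa>) *\<^sub>R N s)"
      by (simp add: fun_eq_iff w_def algebra_simps power2_eq_square flip: scaleR_add_left)
    finally show ?case .
  qed
  show "nabla_T g \<gamma> (2 * m + 1) = (\<lambda>s. ((- w) ^ m * \<kappa>) *\<^sub>R N s)"
    by (rule odd)
  show "nabla_T g \<gamma> (2 * m + 2) =
      (\<lambda>s. ((- w) ^ m * \<kappa>) *\<^sub>R (- \<kappa> *\<^sub>R velocity \<gamma> s + \<tau> *\<^sub>R B s))"
    by (rule even[OF odd])
qed

text \<open>
  With \<open>D = \<tau> b - \<kappa> a\<close>, the term \<open>j = 0\<close> of the tension is \<open>(- w) ^ (r - 2) \<kappa> a N\<close>, while
  each of the \<open>r - 2\<close> others equals \<open>(- w) ^ (r - 3) \<kappa>\<^sup>2 D N\<close>: for odd \<open>j\<close> the sign \<open>(- 1) ^ j\<close>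
  compensates the exchange of the first two arguments of the curvature.
\<close>

lemma r_tension_heis_frenet:
  fixes \<kappa> \<tau> :: real
  defines "w \<equiv> \<kappa>\<^sup>2 + \<tau>\<^sup>2"
  assumes diff: "\<And>s. velocity \<gamma> differentiable (at s)" "\<And>s. N differentiable (at s)"
      "\<And>s. B differentiable (at s)"
    and frenet: "\<And>s. cov_along (heis_metric l) \<gamma> (velocity \<gamma>) s = \<kappa> *\<^sub>R N s"
      "\<And>s. cov_along (heis_metric l) \<gamma> N s = - \<kappa> *\<^sub>R velocity \<gamma> s + \<tau> *\<^sub>R B s"
      "\<And>s. cov_along (heis_metric l) \<gamma> B s = - \<tau> *\<^sub>R N s"
    and NT: "curvature (heis_metric l) (\<gamma> s) (N s) (velocity \<gamma> s) (velocity \<gamma> s) = a *\<^sub>R N s"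
    and NB: "curvature (heis_metric l) (\<gamma> s) (N s) (B s) (velocity \<gamma> s) = b *\<^sub>R N s"
    and \<kappa>: "\<kappa> \<noteq> 0" and r: "r \<ge> 2"
    and eq: "w\<^sup>2 - w * a + real (r - 2) * \<kappa> * (\<tau> * b - \<kappa> * a) = 0"
  shows "r_tension (heis_metric l) r \<gamma> s = 0"
proof -
  define q where "q = r - 2"
  have rq: "r = q + 2" using r by (simp add: q_def)
  note nab = nabla_T_frenet[OF diff frenet, folded w_def]
  let ?R = "\<lambda>u v. curvature (heis_metric l) (\<gamma> s) u v (velocity \<gamma> s)"
  let ?V = "- \<kappa> *\<^sub>R velocity \<gamma> s + \<tau> *\<^sub>R B s"
  have NV: "?R (x *\<^sub>R N s) (y *\<^sub>R ?V) = (x * y * (\<tau> * b - \<kappa> * a)) *\<^sub>R N s" for x y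
  proof -
    have "y *\<^sub>R ?V = (- (y * \<kappa>)) *\<^sub>R velocity \<gamma> s + (y * \<tau>) *\<^sub>R B s"
      by (simp add: algebra_simps)
    then show ?thesis
      by (simp only: curvature_heis_linear NT NB) (simp add: algebra_simps)
  qed
  let ?f = "\<lambda>j. (- 1) ^ j *\<^sub>R ?R (nabla_T (heis_metric l) \<gamma> (2 * r - 3 - j) s)
      (nabla_T (heis_metric l) \<gamma> j s)"
  \<comment> \<open>One of the two orders is odd and the other even and positive. Their exponents of
    \<open>- w\<close> are \<open>m\<close> and \<open>q - 1 - m\<close>, so the product does not
    depend on \<open>i\<close>; \<open>i < q\<close> makes the natural number subtractions
    exact.\<close>
  have f: "?f (Suc i) = ((- w) ^ (q - 1) * \<kappa>\<^sup>2 * (\<tau> * b - \<kappa> * a)) *\<^sub>R N s" if "i < q" for i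
  proof (cases "even i")
    case True
    then obtain m where i: "i = 2 * m" by blast
    have "2 * r - 3 - Suc i = 2 * (q - 1 - m) + 2" "Suc i = 2 * m + 1"
      using that i rq by auto
    moreover have "(- w) ^ (q - 1 - m) * (- w) ^ m = (- w) ^ (q - 1)"
      using that i by (subst power_add[symmetric]) auto
    then have "((- w) ^ (q - 1 - m) * \<kappa>) * ((- w) ^ m * \<kappa>) = (- w) ^ (q - 1) * \<kappa>\<^sup>2"
      "((- w) ^ m * \<kappa>) * ((- w) ^ (q - 1 - m) * \<kappa>) = (- w) ^ (q - 1) * \<kappa>\<^sup>2"
      by (metis mult.assoc mult.commute power2_eq_square)+
    ultimately show ?thesis
      by (simp only: nab curvature_heis_swap[of l "\<gamma> s" "_ *\<^sub>R ?V"] NV)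
        simp
  next
    case False
    then obtain m where i: "i = 2 * m + 1" by (elim oddE)
    have "2 * r - 3 - Suc i = 2 * (q - 1 - m) + 1" "Suc i = 2 * m + 2"
      using that i rq by auto
    moreover have "(- w) ^ (q - 1 - m) * (- w) ^ m = (- w) ^ (q - 1)"
      using that i by (subst power_add[symmetric]) auto
    then have "((- w) ^ (q - 1 - m) * \<kappa>) * ((- w) ^ m * \<kappa>) = (- w) ^ (q - 1) * \<kappa>\<^sup>2"
      "((- w) ^ m * \<kappa>) * ((- w) ^ (q - 1 - m) * \<kappa>) = (- w) ^ (q - 1) * \<kappa>\<^sup>2"
      by (metis mult.assoc mult.commute power2_eq_square)+
    ultimately show ?thesis
      by (simp only: nab NV)
        simp
  qed
  \<comment> \<open>Order \<open>0\<close> is \<open>T\<close> itself, which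
    \<open>nabla_T_frenet\<close> does not cover.\<close>
  have f0: "?f 0 = ((- w) ^ q * \<kappa> * a) *\<^sub>R N s"
  proof -
    have "2 * r - 3 - 0 = 2 * q + 1" using rq by simp
    moreover have "?R (x *\<^sub>R N s) (velocity \<gamma> s) = (x * a) *\<^sub>R N s" for x
      using curvature_heis_linear[of l "\<gamma> s" x "N s" 1 "velocity \<gamma> s" 0 "B s"] by (simp add: NT)
    ultimately show ?thesis
      by (simp only: nab) (simp add: nabla_T_def)
  qed
  have "(\<Sum>j = 0..r - 2. ?f j) = ?f 0 + (\<Sum>i<q. ?f (Suc i))"
    unfolding q_def[symmetric] atMost_atLeast0[symmetric] by (rule sum.atMost_shift)
  also have "(\<Sum>i<q. ?f (Suc i)) = (\<Sum>i<q. ((- w) ^ (q - 1) * \<kappa>\<^sup>2 * (\<tau> * b - \<kappa> * a)) *\<^sub>R N s)"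
    by (rule sum.cong[OF refl]) (simp only: lessThan_iff f)
  also have "\<dots> = (real q * (- w) ^ (q - 1) * \<kappa>\<^sup>2 * (\<tau> * b - \<kappa> * a)) *\<^sub>R N s"
    by (simp only: sum_constant_scaleR) simp
  finally have sum: "(\<Sum>j = 0..r - 2. ?f j) = ((- w) ^ q * \<kappa> * a
      + real q * (- w) ^ (q - 1) * \<kappa>\<^sup>2 * (\<tau> * b - \<kappa> * a)) *\<^sub>R N s"
    unfolding f0 by (simp only: scaleR_add_left)
  have "2 * r - 1 = 2 * (q + 1) + 1" using rq by simp
  then have "r_tension (heis_metric l) r \<gamma> s = ((- w) ^ (q + 1) * \<kappa> + ((- w) ^ q * \<kappa> * a
      + real q * (- w) ^ (q - 1) * \<kappa>\<^sup>2 * (\<tau> * b - \<kappa> * a))) *\<^sub>R N s"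
    by (simp only: r_tension_def sum nab scaleR_add_left)
  moreover have "(- w) ^ (q + 1) * \<kappa> + ((- w) ^ q * \<kappa> * a
      + real q * (- w) ^ (q - 1) * \<kappa>\<^sup>2 * (\<tau> * b - \<kappa> * a)) = 0"
  \<comment> \<open>For \<open>q = 0\<close> the exponent \<open>q - 1\<close> is truncated, but its
    term carries the factor \<open>q\<close>; the condition is then \<open>w = a\<close>, obtained
    by cancelling \<open>w \<noteq> 0\<close>. For \<open>q = n + 1\<close> the factor
    \<open>(- w) ^ n * \<kappa>\<close> splits off.\<close>
  proof (cases q)
    case 0
    then have "w * (w - a) = 0"
      using eq by (simp add: q_def[symmetric] power2_eq_square algebra_simps)
    moreover have "w \<noteq> 0" using \<kappa> by (simp add: w_def sum_power2_eq_zero_iff)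
    ultimately show ?thesis using 0 by simp
  next
    case (Suc n)
    have "(- w) ^ (q + 1) * \<kappa> + ((- w) ^ q * \<kappa> * a
        + real q * (- w) ^ (q - 1) * \<kappa>\<^sup>2 * (\<tau> * b - \<kappa> * a))
      = (- w) ^ n * \<kappa> * (w\<^sup>2 - w * a + real q * \<kappa> * (\<tau> * b - \<kappa> * a))"
      by (simp add: Suc power2_eq_square algebra_simps)
    then show ?thesis using eq by (simp add: q_def)
  qed
  ultimately show ?thesis by simp
qed

section \<open>The explicit helix and its Frenet field\<close>

text \<open>The bracket of \<open>E1\<close> and \<open>E2\<close> is \<open>l E3\<close>, so the
  connection coefficients in the frame are the constants 0 and \<plusminus>l/2. This reduces
  covariant derivatives along the helix to differentiating frame components.\<close>

lemma cov_along_heis_vec: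
  assumes \<gamma>: "(\<gamma> has_vector_derivative heis_vec l (\<gamma> s) t) (at s)"
    and a: "(a has_vector_derivative a') (at s)"
  shows "cov_along (heis_metric l) \<gamma> (\<lambda>s. heis_vec l (\<gamma> s) (a s)) s = heis_vec l (\<gamma> s)
    (a' + (l / 2) *\<^sub>R vector [t $ 2 * a s $ 3 + t $ 3 * a s $ 2,
      - (t $ 1 * a s $ 3 + t $ 3 * a s $ 1), t $ 1 * a s $ 2 - t $ 2 * a s $ 1])"
proof -
  have vec: "heis_vec l p a = vector [a $ 1, a $ 2, a $ 3 + l / 2 * (p $ 1 * a $ 2 - p $ 2 * a $ 1)]"
    for p a by (rule vec3_eqI) (simp_all add: heis_vec_nth)
  note nth = bounded_linear.has_derivative[OF bounded_linear_vec_nth]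
  \<comment> \<open>The term along \<open>heis_E3\<close> is the change of the frame itself as the
    base point moves with velocity \<open>t\<close>.\<close>
  have "((\<lambda>s. heis_vec l (\<gamma> s) (a s)) has_derivative
    (\<lambda>h. h *\<^sub>R (heis_vec l (\<gamma> s) a' + (l / 2 * (t $ 1 * a s $ 2 - t $ 2 * a s $ 1)) *\<^sub>R heis_E3 l (\<gamma> s)))) (at s)"
    unfolding vec
    apply (rule has_derivative_eq_rhs)
     apply (rule has_derivative_vector_3 derivative_intros nth
        assms[unfolded has_vector_derivative_def])+
    apply (rule ext, rule vec3_eqI)
      apply (simp_all add: heis_vec_nth heis_E3_def algebra_simps)
    done
  then show ?thesis
    by (simp add: cov_along_def velocity_def vector_derivative_at[OF \<gamma>]
        vector_derivative_at[unfolded has_vector_derivative_def] christoffel_term_heis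
        heis_form_heis_vec)
      (rule vec3_eqI; simp add: heis_vec_nth heis_E1_def heis_E2_def heis_E3_def; simp add: field_simps)
qed

text \<open>For fixed \<open>b\<close> this family of curves is closed under
  \<open>velocity\<close>, so one derivative computation handles all orders.\<close>

lemma smooth_curve_trig:
  fixes A D M Q :: "'a::real_normed_vector"
  shows "smooth_curve (\<lambda>s. cos (b * s) *\<^sub>R A + sin (b * s) *\<^sub>R D + s *\<^sub>R M + Q)"
proof -
  have d: "((\<lambda>s. cos (b * s) *\<^sub>R A + sin (b * s) *\<^sub>R D + s *\<^sub>R M + Q) has_vector_derivative
      cos (b * s) *\<^sub>R (b *\<^sub>R D) + sin (b * s) *\<^sub>R (- b *\<^sub>R A) + s *\<^sub>R 0 + M) (at s)"
    for A D M Q :: 'a and s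
    by (auto intro!: derivative_eq_intros simp: algebra_simps)
  have ex: "\<exists>A' D' M' Q'. (velocity ^^ k) (\<lambda>s. cos (b * s) *\<^sub>R A + sin (b * s) *\<^sub>R D + s *\<^sub>R M + Q) =
      (\<lambda>s. cos (b * s) *\<^sub>R A' + sin (b * s) *\<^sub>R D' + s *\<^sub>R M' + Q')" for k and A D M Q :: 'a
  proof (induction k)
    case 0
    show ?case by auto
  next
    case (Suc k)
    then obtain A' D' M' Q' where "(velocity ^^ k) (\<lambda>s. cos (b * s) *\<^sub>R A + sin (b * s) *\<^sub>R D + s *\<^sub>R M + Q) =
      (\<lambda>s. cos (b * s) *\<^sub>R A' + sin (b * s) *\<^sub>R D' + s *\<^sub>R M' + Q')" by blast
    then have "(velocity ^^ Suc k) (\<lambda>s. cos (b * s) *\<^sub>R A + sin (b * s) *\<^sub>R D + s *\<^sub>R M + Q) =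
      (\<lambda>s. cos (b * s) *\<^sub>R (b *\<^sub>R D') + sin (b * s) *\<^sub>R (- b *\<^sub>R A') + s *\<^sub>R 0 + M')"
      by (simp add: velocity_def[abs_def] vector_derivative_at[OF d])
    then show ?case by blast
  qed
  have "(velocity ^^ k) (\<lambda>s. cos (b * s) *\<^sub>R A + sin (b * s) *\<^sub>R D + s *\<^sub>R M + Q)
      differentiable (at s)" for k s
  proof -
    obtain A' D' M' Q' where
      eq: "(velocity ^^ k) (\<lambda>s. cos (b * s) *\<^sub>R A + sin (b * s) *\<^sub>R D + s *\<^sub>R M + Q) =
        (\<lambda>s. cos (b * s) *\<^sub>R A' + sin (b * s) *\<^sub>R D' + s *\<^sub>R M' + Q')"
      using ex[of k A D M Q] by blast
    show ?thesis
      unfolding eq by (rule differentiableI_vector[OF d])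
  qed
  then show ?thesis
    unfolding smooth_curve_def by blast
qed

lemma smooth_curve_differentiable: "smooth_curve \<gamma> \<Longrightarrow> \<gamma> differentiable (at s)"
  unfolding smooth_curve_def by (metis funpow_0)

lemma smooth_curve_velocity: "smooth_curve \<gamma> \<Longrightarrow> smooth_curve (velocity \<gamma>)"
  unfolding smooth_curve_def by (metis comp_apply funpow_Suc_right)

text \<open>The integral curve of the prescribed \<open>T\<close> with
  \<open>\<beta>(s) = b s\<close>. The integration constants put the projection to the xy-plane on a
  circle about the origin, for which \<open>x y' - y x'\<close> is constant and the third coordinate
  linear in \<open>s\<close>.\<close>

definition heis_helix :: "real \<Rightarrow> real \<Rightarrow> real \<Rightarrow> real \<Rightarrow> real^3"
  where "heis_helix l \<alpha> b s = vector [sin \<alpha> / b * sin (b * s), - (sin \<alpha> / b * cos (b * s)),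
    (cos \<alpha> + l * (sin \<alpha>)\<^sup>2 / (2 * b)) * s]"

definition helix_N :: "real \<Rightarrow> real \<Rightarrow> real \<Rightarrow> real \<Rightarrow> real^3"
  where "helix_N l \<alpha> b s = heis_vec l (heis_helix l \<alpha> b s) (vector [- sin (b * s), cos (b * s), 0])"

definition helix_B :: "real \<Rightarrow> real \<Rightarrow> real \<Rightarrow> real \<Rightarrow> real^3"
  where "helix_B l \<alpha> b s = heis_vec l (heis_helix l \<alpha> b s)
    (vector [- cos \<alpha> * cos (b * s), - cos \<alpha> * sin (b * s), sin \<alpha>])"

text \<open>Rewrite rules eliminating squares of the cosine from multiplied-out expressions; the
  second finds the square inside a longer right-nested product.\<close>

lemma cos_square_reduce:
  fixes x y :: real
  shows "cos x * cos x = 1 - sin x * sin x" "cos x * (cos x * y) = y - sin x * (sin x * y)"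
proof -
  show "cos x * cos x = 1 - sin x * sin x"
    by (metis cos_squared_eq power2_eq_square)
  then show "cos x * (cos x * y) = y - sin x * (sin x * y)"
    by (simp only: mult.assoc[symmetric]) (simp add: left_diff_distrib)
qed

lemma heis_helix_has_vector_derivative:
  assumes "b \<noteq> 0"
  shows "(heis_helix l \<alpha> b has_vector_derivative heis_vec l (heis_helix l \<alpha> b s)
    (vector [sin \<alpha> * cos (b * s), sin \<alpha> * sin (b * s), cos \<alpha>])) (at s)"
proof -
  have "heis_vec l (heis_helix l \<alpha> b s) (vector [sin \<alpha> * cos (b * s), sin \<alpha> * sin (b * s), cos \<alpha>])
    = vector [sin \<alpha> * cos (b * s), sin \<alpha> * sin (b * s), cos \<alpha> + l * (sin \<alpha>)\<^sup>2 / (2 * b)]"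
    using assms by (intro vec3_eqI)
      (simp_all add: heis_vec_nth heis_helix_def field_simps power2_eq_square cos_square_reduce)
  moreover have "(heis_helix l \<alpha> b has_derivative (\<lambda>h. vector [h * (sin \<alpha> * cos (b * s)),
      h * (sin \<alpha> * sin (b * s)), h * (cos \<alpha> + l * (sin \<alpha>)\<^sup>2 / (2 * b))])) (at s)"
    unfolding heis_helix_def[abs_def]
    by (rule has_derivative_vector_3; use assms in \<open>auto intro!: derivative_eq_intros ext\<close>)
  moreover have "vector [h * x, h * y, h * z] = h *\<^sub>R (vector [x, y, z] :: real^3)" for h x y z :: real
    by (rule vec3_eqI) simp_all
  ultimately show ?thesis
    by (simp add: has_vector_derivative_def)
qed

lemma smooth_heis_helix: "smooth_curve (heis_helix l \<alpha> b)"
  and smooth_helix_N: "smooth_curve (helix_N l \<alpha> b)"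
  and smooth_helix_B: "smooth_curve (helix_B l \<alpha> b)"
proof -
  have "heis_helix l \<alpha> b = (\<lambda>s. cos (b * s) *\<^sub>R (- (sin \<alpha> / b)) *\<^sub>R axis 2 1
      + sin (b * s) *\<^sub>R (sin \<alpha> / b) *\<^sub>R axis 1 1
      + s *\<^sub>R (cos \<alpha> + l * (sin \<alpha>)\<^sup>2 / (2 * b)) *\<^sub>R axis 3 1 + 0)"
    by (rule ext, rule vec3_eqI) (simp_all add: heis_helix_def axis_def)
  then show "smooth_curve (heis_helix l \<alpha> b)"
    by (simp only: smooth_curve_trig)
  have "helix_N l \<alpha> b = (\<lambda>s. cos (b * s) *\<^sub>R axis 2 1 + sin (b * s) *\<^sub>R (- axis 1 1) + s *\<^sub>R 0 + 0)"
    by (rule ext, rule vec3_eqI) (simp_all add: helix_N_def heis_helix_def heis_vec_nth axis_def)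
  then show "smooth_curve (helix_N l \<alpha> b)"
    by (simp only: smooth_curve_trig)
  \<comment> \<open>The oscillating parts combine to \<open>sin^2 + cos^2\<close>. For
    \<open>b = 0\<close> both sides are \<open>sin \<alpha>\<close>, since division by zero yields
    zero.\<close>
  have "helix_B l \<alpha> b s $ 3 = sin \<alpha> - l * cos \<alpha> * sin \<alpha> / (2 * b)" for s
    by (cases "b = 0") (simp_all add: helix_B_def heis_helix_def heis_vec_nth field_simps cos_square_reduce)
  then have "helix_B l \<alpha> b = (\<lambda>s. cos (b * s) *\<^sub>R (- cos \<alpha>) *\<^sub>R axis 1 1
      + sin (b * s) *\<^sub>R (- cos \<alpha>) *\<^sub>R axis 2 1 + s *\<^sub>R 0
      + (sin \<alpha> - l * cos \<alpha> * sin \<alpha> / (2 * b)) *\<^sub>R axis 3 1)"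
    by (intro ext vec3_eqI) (simp_all add: helix_B_def heis_vec_nth axis_def)
  then show "smooth_curve (helix_B l \<alpha> b)"
    by (simp only: smooth_curve_trig)
qed

lemma velocity_heis_helix:
  "b \<noteq> 0 \<Longrightarrow> velocity (heis_helix l \<alpha> b) = (\<lambda>s. heis_vec l (heis_helix l \<alpha> b s)
    (vector [sin \<alpha> * cos (b * s), sin \<alpha> * sin (b * s), cos \<alpha>]))"
  unfolding velocity_def by (rule ext, rule vector_derivative_at, rule heis_helix_has_vector_derivative)

text \<open>Rotation at speed \<open>b\<close> contributes \<open>b sin \<alpha> N\<close> to the
  derivative of \<open>T\<close>, and the connection contributes
  \<open>- l cos \<alpha> sin \<alpha> N\<close>. Thus \<open>\<zeta> = b - l cos \<alpha>\<close>
  is the speed that the covariant derivative sees.\<close>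

lemma frenet_heis_helix:
  assumes "0 < \<alpha>" "\<alpha> < pi" "\<zeta> > 0" and b: "b = \<zeta> + l * cos \<alpha>" "b \<noteq> 0"
  shows "frenet_helix l (heis_helix l \<alpha> b) (helix_N l \<alpha> b) (helix_B l \<alpha> b)
    (\<zeta> * sin \<alpha>) (\<zeta> * cos \<alpha> + l / 2)"
proof -
  let ?\<gamma> = "heis_helix l \<alpha> b" and ?N = "helix_N l \<alpha> b" and ?B = "helix_B l \<alpha> b"
  let ?t = "\<lambda>s. vector [sin \<alpha> * cos (b * s), sin \<alpha> * sin (b * s), cos \<alpha>] :: real^3"
  let ?n = "\<lambda>s. vector [- sin (b * s), cos (b * s), 0] :: real^3"
  let ?b = "\<lambda>s. vector [- cos \<alpha> * cos (b * s), - cos \<alpha> * sin (b * s), sin \<alpha>] :: real^3"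
  note V = velocity_heis_helix[OF \<open>b \<noteq> 0\<close>] and N = helix_N_def and B = helix_B_def
  have vec: "((\<lambda>s. vector [f s, g s, h s] :: real^3) has_vector_derivative vector [f', g', h']) (at s)"
    if "(f has_real_derivative f') (at s)" "(g has_real_derivative g') (at s)"
      "(h has_real_derivative h') (at s)" for f g h :: "real \<Rightarrow> real" and f' g' h' s
  proof -
    have "(\<lambda>x. vector [f' * x, g' * x, h' * x] :: real^3) = (\<lambda>x. x *\<^sub>R vector [f', g', h'])"
      by (rule ext, rule vec3_eqI) simp_all
    then show ?thesis
      using has_derivative_vector_3[OF that[unfolded has_field_derivative_def]]
      by (simp add: has_vector_derivative_def)
  qed
  have t': "(?t has_vector_derivative (sin \<alpha> * b) *\<^sub>R ?n s) (at s)" for s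
    by (rule has_vector_derivative_eq_rhs, rule vec)
      (auto intro!: derivative_eq_intros vec3_eqI)
  have n': "(?n has_vector_derivative (- b) *\<^sub>R vector [cos (b * s), sin (b * s), 0]) (at s)" for s
    by (rule has_vector_derivative_eq_rhs, rule vec)
      (auto intro!: derivative_eq_intros vec3_eqI)
  have b': "(?b has_vector_derivative (- cos \<alpha> * b) *\<^sub>R ?n s) (at s)" for s
    by (rule has_vector_derivative_eq_rhs, rule vec)
      (auto intro!: derivative_eq_intros vec3_eqI)
  note cov = cov_along_heis_vec[OF heis_helix_has_vector_derivative[OF \<open>b \<noteq> 0\<close>]]
  have T: "cov_along (heis_metric l) ?\<gamma> (velocity ?\<gamma>) s = (\<zeta> * sin \<alpha>) *\<^sub>R ?N s" for s
    unfolding V N cov[OF t'] heis_vec_scaleR[symmetric]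
    by (rule arg_cong[where f = "heis_vec l _"], rule vec3_eqI) (simp_all add: b algebra_simps)
  have N': "cov_along (heis_metric l) ?\<gamma> ?N s =
      - (\<zeta> * sin \<alpha>) *\<^sub>R velocity ?\<gamma> s + (\<zeta> * cos \<alpha> + l / 2) *\<^sub>R ?B s" for s
    unfolding V N[abs_def] B cov[OF n'] heis_vec_scaleR[symmetric] heis_vec_add[symmetric]
    by (rule arg_cong[where f = "heis_vec l _"], rule vec3_eqI)
      (simp_all add: b algebra_simps cos_square_reduce)
  have B': "cov_along (heis_metric l) ?\<gamma> ?B s = - (\<zeta> * cos \<alpha> + l / 2) *\<^sub>R ?N s" for s
    unfolding N B[abs_def] cov[OF b'] heis_vec_scaleR[symmetric]
    by (rule arg_cong[where f = "heis_vec l _"], rule vec3_eqI)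
      (simp_all add: b algebra_simps cos_square_reduce)
  have inner: "?t s \<bullet> ?t s = 1" "?n s \<bullet> ?n s = 1" "?b s \<bullet> ?b s = 1"
      "?t s \<bullet> ?n s = 0" "?t s \<bullet> ?b s = 0" "?n s \<bullet> ?b s = 0" for s
    by (simp_all add: inner_vec_def sum_3 algebra_simps cos_square_reduce)
  have cross: "?b s = cross3 (?t s) (?n s)" for s
    by (rule vec3_eqI) (simp_all add: cross3_def algebra_simps cos_square_reduce)
  have orth: "metric_inner (heis_metric l) (?\<gamma> s) (velocity ?\<gamma> s) (velocity ?\<gamma> s) = 1"
      "metric_inner (heis_metric l) (?\<gamma> s) (?N s) (?N s) = 1"
      "metric_inner (heis_metric l) (?\<gamma> s) (?B s) (?B s) = 1"
      "metric_inner (heis_metric l) (?\<gamma> s) (velocity ?\<gamma> s) (?N s) = 0"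
      "metric_inner (heis_metric l) (?\<gamma> s) (velocity ?\<gamma> s) (?B s) = 0"
      "metric_inner (heis_metric l) (?\<gamma> s) (?N s) (?B s) = 0" for s
    unfolding V N B metric_inner_heis_vec by (rule inner)+
  have wedge: "?B s = heis_wedge l (?\<gamma> s) (velocity ?\<gamma> s) (?N s)" for s
    unfolding V N B heis_wedge_heis_vec cross ..
  have "\<zeta> * sin \<alpha> > 0" using assms by (simp add: sin_gt_zero)
  then show ?thesis
    unfolding frenet_helix_def Let_def arclength_curve_def
    by (intro conjI allI smooth_heis_helix smooth_helix_N smooth_helix_B T N' B' orth wedge)
qed

text \<open>On bivectors, identified with vectors by the cross product, the curvature operator is
  \<open>l^2/4\<close> times the identity minus \<open>l^2\<close> times the projection to
  \<open>E3 = cos \<alpha> T + sin \<alpha> B\<close>. The first constant is the sectional curvature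
  of the plane of \<open>T\<close> and \<open>N\<close>; the second is an off-diagonal
  entry.\<close>

lemma heis_helix_curvature:
  fixes l \<alpha> b s :: real
  assumes "b \<noteq> 0"
  defines "R \<equiv> curvature (heis_metric l) (heis_helix l \<alpha> b s)"
    and "T \<equiv> velocity (heis_helix l \<alpha> b) s"
  shows "R (helix_N l \<alpha> b s) T T = (l\<^sup>2 / 4 - l\<^sup>2 * (sin \<alpha>)\<^sup>2) *\<^sub>R helix_N l \<alpha> b s"
    and "R (helix_N l \<alpha> b s) (helix_B l \<alpha> b s) T = (l\<^sup>2 * sin \<alpha> * cos \<alpha>) *\<^sub>R helix_N l \<alpha> b s"
  unfolding R_def T_def velocity_heis_helix[OF \<open>b \<noteq> 0\<close>] helix_N_def helix_B_def curvature_heis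
    heis_vec_scaleR[symmetric]
  by (rule arg_cong[where f = "heis_vec l _"], rule vec3_eqI;
      simp add: cross3_def field_simps power2_eq_square cos_square_reduce)+

section \<open>The tension equation as a polynomial equation\<close>

text \<open>
  This is the tension equation with \<open>\<zeta> = \<bar>l\<bar> / 4\<close> and \<open>l cos \<alpha> = - \<bar>l\<bar> c\<close>, divided by \<open>l\<^sup>4\<close>.
  The bound \<open>c > 1 / 4\<close> keeps the slope \<open>\<bar>l\<bar> (1 / 4 - c)\<close> of \<open>\<beta>\<close> away from \<open>0\<close>.
\<close>

lemma tension_polynomial_root:
  fixes q :: nat
  obtains c :: real where "1 / 4 < c" "c < 1"
    "(5 / 16 - c / 4)\<^sup>2 + (5 / 16 - c / 4) * (3 / 4 - c\<^sup>2)
      + real q * (1 - c\<^sup>2) * (3 / 64 - c / 8) = 0"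
proof -
  let ?f = "\<lambda>c :: real. (5 / 16 - c / 4)\<^sup>2 + (5 / 16 - c / 4) * (3 / 4 - c\<^sup>2)
      + real q * (1 - c\<^sup>2) * (3 / 64 - c / 8)"
  \<comment> \<open>The coefficient of \<open>real q\<close> is positive at 1/4 and vanishes at 1,
    so the same endpoints have opposite signs for every \<open>q\<close>.\<close>
  have 1: "?f (1 / 4) > 0"
    by (simp add: power2_eq_square add_pos_nonneg)
  have 2: "?f 1 < 0"
    by (simp add: power2_eq_square)
  have "\<exists>c \<ge> 1 / 4. c \<le> 1 \<and> ?f c = 0"
    using 1 2 by (intro IVT2') (auto intro!: continuous_intros)
  then obtain c where c: "1 / 4 \<le> c" "c \<le> 1" "?f c = 0"
    by blast
  moreover have "c \<noteq> 1 / 4" "c \<noteq> 1"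
    using 1 2 c(3) by (metis less_irrefl)+
  ultimately show ?thesis
    using that[of c] by simp
qed

theorem theorem4p3:
  fixes l :: real and r :: nat
  assumes "l \<noteq> 0" and "r \<ge> 2"
  shows "\<exists>(\<gamma> :: real \<Rightarrow> real^3) (N :: real \<Rightarrow> real^3) (B :: real \<Rightarrow> real^3) (\<kappa> :: real) (\<tau> :: real).
    proper_r_harmonic (heis_metric l) r \<gamma> \<and>
    frenet_helix l \<gamma> N B \<kappa> \<tau> \<and>
    (\<exists>(\<alpha> :: real) (\<zeta> :: real) (c :: real) (\<beta> :: real \<Rightarrow> real).
      0 < \<alpha> \<and> \<alpha> < pi \<and> \<zeta> > 0 \<and>
      ((\<forall>s. \<beta> s = (\<zeta> + l * cos \<alpha>) * s + c) \<or> (\<forall>s. \<beta> s = (- \<zeta> + l * cos \<alpha>) * s + c)) \<and>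
      \<not> \<beta> constant_on UNIV \<and>
      (\<forall>s. velocity \<gamma> s =
             (sin \<alpha> * cos (\<beta> s)) *\<^sub>R heis_E1 l (\<gamma> s)
             + (sin \<alpha> * sin (\<beta> s)) *\<^sub>R heis_E2 l (\<gamma> s)
             + cos \<alpha> *\<^sub>R heis_E3 l (\<gamma> s)) \<and>
      (\<forall>s. N s = - sin (\<beta> s) *\<^sub>R heis_E1 l (\<gamma> s) + cos (\<beta> s) *\<^sub>R heis_E2 l (\<gamma> s)) \<and>
      (\<forall>s. B s =
             (- cos \<alpha> * cos (\<beta> s)) *\<^sub>R heis_E1 l (\<gamma> s)
             + (- cos \<alpha> * sin (\<beta> s)) *\<^sub>R heis_E2 l (\<gamma> s)
             + sin \<alpha> *\<^sub>R heis_E3 l (\<gamma> s)))"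
proof -
  obtain c :: real where c: "1 / 4 < c" "c < 1" and
    root: "(5 / 16 - c / 4)\<^sup>2 + (5 / 16 - c / 4) * (3 / 4 - c\<^sup>2)
      + real (r - 2) * (1 - c\<^sup>2) * (3 / 64 - c / 8) = 0"
    by (rule tension_polynomial_root)
  define \<alpha> where "\<alpha> = arccos (- (sgn l * c))"
  \<comment> \<open>This choice makes \<open>l cos \<alpha> = - \<bar>l\<bar> c\<close>, so that the sign of \<open>l\<close> disappears.\<close>
  define \<zeta> where "\<zeta> = \<bar>l\<bar> / 4"
  define b where "b = \<zeta> + l * cos \<alpha>"
  have sgn: "sgn l = 1 \<or> sgn l = - 1"
    using \<open>l \<noteq> 0\<close> by (simp add: sgn_if)
  have cos: "cos \<alpha> = - (sgn l * c)"
    using sgn c by (auto simp: \<alpha>_def cos_arccos_abs)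
  have \<alpha>: "0 < \<alpha>" "\<alpha> < pi"
    using arccos_lt_bounded[of "- (sgn l * c)"] sgn c by (auto simp: \<alpha>_def)
  have \<zeta>: "\<zeta> > 0"
    using \<open>l \<noteq> 0\<close> by (simp add: \<zeta>_def)
  have lcos: "l * cos \<alpha> = - (4 * \<zeta> * c)"
    by (simp add: cos \<zeta>_def abs_sgn)
  have b: "b \<noteq> 0"
  proof -
    have "b = \<zeta> * (1 - 4 * c)" by (simp add: b_def lcos algebra_simps)
    then show ?thesis using \<zeta> c by simp
  qed
  have cos2: "(cos \<alpha>)\<^sup>2 = c\<^sup>2"
    using sgn by (auto simp: cos power_mult_distrib)
  have sin2: "(sin \<alpha>)\<^sup>2 = 1 - c\<^sup>2"
    by (simp add: sin_squared_eq cos2)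
  have l2: "l\<^sup>2 = 16 * \<zeta>\<^sup>2"
    by (simp add: \<zeta>_def power_divide)
  let ?\<gamma> = "heis_helix l \<alpha> b" and ?N = "helix_N l \<alpha> b" and ?B = "helix_B l \<alpha> b"
  define \<kappa> \<tau> where "\<kappa> = \<zeta> * sin \<alpha>" and "\<tau> = \<zeta> * cos \<alpha> + l / 2"
  have frenet: "frenet_helix l ?\<gamma> ?N ?B \<kappa> \<tau>"
    unfolding \<kappa>_def \<tau>_def using \<alpha> \<zeta> b_def b by (rule frenet_heis_helix)
  have w: "\<kappa>\<^sup>2 + \<tau>\<^sup>2 = 16 * \<zeta>\<^sup>2 * (5 / 16 - c / 4)"
  proof -
    have "\<kappa>\<^sup>2 + \<tau>\<^sup>2 = \<zeta>\<^sup>2 + \<zeta> * (l * cos \<alpha>) + l\<^sup>2 / 4"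
      by (simp add: \<kappa>_def \<tau>_def power2_eq_square algebra_simps cos_square_reduce)
    then show ?thesis
      unfolding lcos l2 by (simp add: power2_eq_square algebra_simps)
  qed
  have \<rho>: "\<kappa> * (\<tau> * (l\<^sup>2 * sin \<alpha> * cos \<alpha>) - \<kappa> * (l\<^sup>2 / 4 - l\<^sup>2 * (sin \<alpha>)\<^sup>2))
      = 256 * \<zeta>^4 * ((1 - c\<^sup>2) * (3 / 64 - c / 8))"
  proof -
    have "\<kappa> * (\<tau> * (l\<^sup>2 * sin \<alpha> * cos \<alpha>) - \<kappa> * (l\<^sup>2 / 4 - l\<^sup>2 * (sin \<alpha>)\<^sup>2))
      = \<zeta> * l\<^sup>2 * (sin \<alpha>)\<^sup>2 * (3 / 4 * \<zeta> + l * cos \<alpha> / 2)"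
      by (simp add: \<kappa>_def \<tau>_def power2_eq_square algebra_simps cos_square_reduce)
    also have "\<dots> = 256 * \<zeta>^4 * ((1 - c\<^sup>2) * (3 / 64 - c / 8))"
      unfolding lcos l2 sin2 by (simp add: power2_eq_square power4_eq_xxxx field_simps)
    finally show ?thesis .
  qed
  \<comment> \<open>All terms share the factor \<open>256 * \<zeta>^4\<close>, which is
    \<open>l^4\<close>; dividing by it leaves the polynomial with root \<open>c\<close>.\<close>
  have eq: "(\<kappa>\<^sup>2 + \<tau>\<^sup>2)\<^sup>2 - (\<kappa>\<^sup>2 + \<tau>\<^sup>2) * (l\<^sup>2 / 4 - l\<^sup>2 * (sin \<alpha>)\<^sup>2)
      + real (r - 2) * \<kappa> * (\<tau> * (l\<^sup>2 * sin \<alpha> * cos \<alpha>) - \<kappa> * (l\<^sup>2 / 4 - l\<^sup>2 * (sin \<alpha>)\<^sup>2)) = 0"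
  proof -
    have "(\<kappa>\<^sup>2 + \<tau>\<^sup>2)\<^sup>2 - (\<kappa>\<^sup>2 + \<tau>\<^sup>2) * (l\<^sup>2 / 4 - l\<^sup>2 * (sin \<alpha>)\<^sup>2)
      + real (r - 2) * \<kappa> * (\<tau> * (l\<^sup>2 * sin \<alpha> * cos \<alpha>) - \<kappa> * (l\<^sup>2 / 4 - l\<^sup>2 * (sin \<alpha>)\<^sup>2))
      = 256 * \<zeta>^4 * ((5 / 16 - c / 4)\<^sup>2 + (5 / 16 - c / 4) * (3 / 4 - c\<^sup>2)
      + real (r - 2) * (1 - c\<^sup>2) * (3 / 64 - c / 8))"
      unfolding w mult.assoc[of "real (r - 2)"] \<rho>
      unfolding l2 sin2 by (simp add: power2_eq_square power4_eq_xxxx field_simps)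
    then show ?thesis unfolding root by simp
  qed
  have \<kappa>: "\<kappa> > 0"
    using \<zeta> \<alpha> by (simp add: \<kappa>_def sin_gt_zero)
  have geod: "\<And>s. cov_along (heis_metric l) ?\<gamma> (velocity ?\<gamma>) s = \<kappa> *\<^sub>R ?N s"
    and N: "\<And>s. cov_along (heis_metric l) ?\<gamma> ?N s = - \<kappa> *\<^sub>R velocity ?\<gamma> s + \<tau> *\<^sub>R ?B s"
    and B: "\<And>s. cov_along (heis_metric l) ?\<gamma> ?B s = - \<tau> *\<^sub>R ?N s"
    and arc: "arclength_curve (heis_metric l) ?\<gamma>"
    and unit: "\<And>s. metric_inner (heis_metric l) (?\<gamma> s) (?N s) (?N s) = 1"
    using frenet unfolding frenet_helix_def Let_def by blast+
  have "r_tension (heis_metric l) r ?\<gamma> s = 0" for s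
    using \<kappa> \<open>r \<ge> 2\<close>
    by (intro r_tension_heis_frenet[OF _ _ _ geod N B heis_helix_curvature[OF b] _ _ eq]
        smooth_curve_differentiable smooth_curve_velocity smooth_heis_helix smooth_helix_N
        smooth_helix_B) auto
  moreover have "\<not> geodesic (heis_metric l) ?\<gamma>"
  proof
    assume "geodesic (heis_metric l) ?\<gamma>"
    then have "?N 0 = 0"
      using geod \<kappa> by (simp add: geodesic_def)
    then show False
      using unit[of 0] by (simp add: metric_inner_def)
  qed
  ultimately have harm: "proper_r_harmonic (heis_metric l) r ?\<gamma>"
    using arc by (simp add: proper_r_harmonic_def r_harmonic_def)
  have nonconst: "\<not> (\<lambda>s. b * s) constant_on UNIV"
  proof
    assume "(\<lambda>s. b * s) constant_on UNIV"
    then obtain y where "\<And>s. b * s = y" by (auto simp: constant_on_def)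
    from this[of 0] this[of 1] show False using b by simp
  qed
  \<comment> \<open>The plus sign and phase \<open>0\<close> are used, because
    \<open>heis_helix\<close> was built with \<open>\<beta>(s) = b s\<close>.\<close>
  show ?thesis
    by (rule exI[of _ ?\<gamma>], rule exI[of _ ?N], rule exI[of _ ?B], rule exI[of _ \<kappa>], rule exI[of _ \<tau>],
        intro conjI harm frenet, rule exI[of _ \<alpha>], rule exI[of _ \<zeta>], rule exI[of _ 0],
        rule exI[of _ "\<lambda>s. b * s"], intro conjI \<alpha> \<zeta> nonconst)
      (simp_all add: b_def[symmetric] velocity_heis_helix[OF b] helix_N_def helix_B_def heis_vec_def)
qed

end
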